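(* Let $\mathcal{A}$ be a Rickart *-ring and $b\in\mathcal{A}$. Put $b_l=b\,\mathrm{lp}(b)$. Then: (a) the poset $[0,b]^{\ell*}=\{a\in\mathcal{A}: a\preceq^{\ell*} b\}$ is order-isomorphic to $E_b^{\ell*}=\{p\in E(\mathcal{A}): p\le\mathrm{lp}(b)\}$; (b) the poset $[0,b]^{\ell*|r\square}=\{a\in\mathcal{A}: a\preceq^{\ell*|r\square} b\}$ is order-isomorphic to $E_b^{\ell*|r\square}=\{p\in E(\mathcal{A}): p\le\mathrm{lp}(b),\ pb_lp=b_lp\}$; (c) the poset $[0,b]^{\ell*|\ell\square}=\{a\in\mathcal{A}: a\preceq^{\ell*|\ell\square} b\}$ is order-isomorphic to $E_b^{\ell*|\ell\square}=\{p\in E(\mathcal{A}): p\le\mathrm{lp}(b),\ pb_lp=pb_l\}$; (d) the poset $[0,b]^{\ell*|\square}=\{a\in\mathcal{A}: a\preceq^{\ell*|\square} b\}$ is order-isomorphic to $E_b^{\ell*|\square}=\{p\in E(\mathcal{A}): p\le\mathrm{lp}(b),\ pb_l=b_lp\}$. Here each $[0,b]^{\alpha}$ is ordered by the corresponding $\preceq^{\alpha}$ and each $E_b^{\alpha}$ is ordered by $\le$.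
   Context: A *-ring is an (associative) ring $\mathcal{A}$ with an involution $*$: $(a+b)^*=a^*+b^*$, $(ab)^*=b^*a^*$, $(a^* )^*=a$. It is a Rickart *-ring if for every $a\in\mathcal{A}$ there is a self-adjoint idempotent $p$ (i.e. $p=p^*=p^2$) with $\{x\in\mathcal{A}: xa=0\}=\mathcal{A}(1-p)$; such a ring has an identity $1$, and $p$ is unique and denoted $\mathrm{lp}(a)$. Likewise, for every $a$ there is a unique self-adjoint idempotent $\mathrm{rp}(a)$ with $\{x\in\mathcal{A}: ax=0\}=(1-\mathrm{rp}(a))\mathcal{A}$. $E(\mathcal{A})$ is the set of self-adjoint idempotents, partially ordered by $p\le q$ iff $p=pq$. The following are partial orders on $\mathcal{A}$: $a\preceq^{\ell*} b$ iff $\mathrm{lp}(a)b=a=\mathrm{lp}(b)a$ (left star order); $a\preceq^{\ell*|\ell\square} b$ iff $a\preceq^{\ell*}b$ and $a^2=ab$; $a\preceq^{\ell*|r\square} b$ iff $a\preceq^{\ell*}b$ and $a^2=ba$; $a\preceq^{\ell*|\square} b$ iff $a\preceq^{\ell*}b$ and $a^2=ab=ba$. Two posets are order-isomorphic if there is a bijection between them which is order-preserving with order-preserving inverse. *)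

theory Defs
  imports Main
begin

text \<open>
  The sort \<open>ring + monoid_mult\<close> is that of unital associative rings without the axiom
  \<open>0 \<noteq> 1\<close>, so that the zero ring is included (\<open>ring_1\<close> would exclude it).
\<close>

class star_ring = ring + monoid_mult +
  fixes star :: "'a \<Rightarrow> 'a"
  assumes star_add: "star (a + b) = star a + star b"
    and star_mult: "star (a * b) = star b * star a"
    and star_star: "star (star a) = a"

definition projections :: "'a::star_ring set" where
  "projections = {p. p = star p \<and> p = p * p}"

definition proj_le :: "'a::star_ring \<Rightarrow> 'a \<Rightarrow> bool" where
  "proj_le p q \<longleftrightarrow> p = p * q"

definition is_lp :: "'a::star_ring \<Rightarrow> 'a \<Rightarrow> bool" where
  "is_lp a p \<longleftrightarrow> p \<in> projections \<and> {x. x * a = 0} = {y * (1 - p) | y. True}"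

class rickart_star_ring = star_ring +
  assumes rickart:
    "\<exists>p. p = star p \<and> p = p * p \<and> {x. x * a = 0} = {y * (1 - p) | y. True}"

definition lp :: "'a::rickart_star_ring \<Rightarrow> 'a" where
  "lp a = (THE p. is_lp a p)"

lemma is_lp_unique:
  assumes "is_lp a p" and "is_lp a q"
  shows "p = q"
proof -
  have eq: "{y * (1 - p) | y. True} = {y * (1 - q) | y. True}"
    using assms unfolding is_lp_def by blast
  have proj: "star p = p" "star q = q" "p * p = p" "q * q = q"
    using assms unfolding is_lp_def projections_def mem_Collect_eq by metis+
  have absorb: "s = r * s"
    if sub: "{y * (1 - r) | y. True} \<subseteq> {y * (1 - s) | y. True}" and s: "s * s = s"
    for r s :: 'a
  proof -
    have "1 * (1 - r) \<in> {y * (1 - s) | y. True}" using sub by blast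
    then obtain y where "1 - r = y * (1 - s)" by auto
    then have "(1 - r) * s = y * ((1 - s) * s)" by (simp add: mult.assoc)
    also have "\<dots> = 0" using s by (simp add: left_diff_distrib)
    finally have "s - r * s = 0" by (simp only: left_diff_distrib mult_1_left)
    then show ?thesis by (simp only: right_minus_eq)
  qed
  have "q = p * q"
    by (rule absorb) (use eq proj in blast)+
  moreover have "p = q * p"
    by (rule absorb) (use eq proj in blast)+
  ultimately show ?thesis by (metis proj(1,2) star_mult)
qed

lemma is_lp_lp: "is_lp a (lp a)"
proof -
  have "\<exists>!p. is_lp a p"
    using rickart[of a] is_lp_unique[of a] unfolding is_lp_def projections_def mem_Collect_eq
    by blast
  then show ?thesis unfolding lp_def by (rule theI')
qed

definition left_star_le :: "'a::rickart_star_ring \<Rightarrow> 'a \<Rightarrow> bool" where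
  "left_star_le a b \<longleftrightarrow> lp a * b = a \<and> a = lp b * a"

definition left_star_lsq_le :: "'a::rickart_star_ring \<Rightarrow> 'a \<Rightarrow> bool" where
  "left_star_lsq_le a b \<longleftrightarrow> left_star_le a b \<and> a * a = a * b"

definition left_star_rsq_le :: "'a::rickart_star_ring \<Rightarrow> 'a \<Rightarrow> bool" where
  "left_star_rsq_le a b \<longleftrightarrow> left_star_le a b \<and> a * a = b * a"

definition left_star_sq_le :: "'a::rickart_star_ring \<Rightarrow> 'a \<Rightarrow> bool" where
  "left_star_sq_le a b \<longleftrightarrow> left_star_le a b \<and> a * a = a * b \<and> a * b = b * a"

definition order_isomorphic ::
  "'a set \<Rightarrow> ('a \<Rightarrow> 'a \<Rightarrow> bool) \<Rightarrow> 'b set \<Rightarrow> ('b \<Rightarrow> 'b \<Rightarrow> bool) \<Rightarrow> bool" where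
  "order_isomorphic A leA B leB \<longleftrightarrow>
     (\<exists>f. bij_betw f A B \<and> monotone_on A leA leB f \<and> monotone_on B leB leA (the_inv_into A f))"

end

theory Submission
  imports Defs
begin

text \<open>
  The left annihilator of \<open>a\<close> is that of \<open>lp a\<close>, so \<open>lp b\<close> may replace a right factor \<open>b\<close> in
  any equation. Hence \<open>lp (p * b) = p\<close> whenever \<open>p\<close> is a projection below \<open>lp b\<close>, so that
  \<open>a \<mapsto> lp a\<close> and \<open>p \<mapsto> p * b\<close> are mutually inverse between the left star interval and the
  projections below \<open>lp b\<close>. The same cancellation turns the side conditions on \<open>a = p * b\<close> into
  the conditions on \<open>p\<close>. For elements of the smaller intervals, the side conditions relative
  to \<open>b\<close> imply those relative to each other, so every order involved restricts the left star
  order.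
\<close>

lemma lp_proj: "star (lp a) = lp a" "lp a * lp a = lp a"
  using is_lp_lp[of a] unfolding is_lp_def projections_def mem_Collect_eq by metis+

lemma mult_eq_0_iff_mult_lp: "x * a = 0 \<longleftrightarrow> x * lp a = 0"
proof -
  have ann: "{x. x * a = 0} = {y * (1 - lp a) | y. True}"
    using is_lp_lp[of a] unfolding is_lp_def by blast
  show ?thesis
  proof
    assume "x * a = 0"
    then obtain y where "x = y * (1 - lp a)" using ann by blast
    then show "x * lp a = 0"
      by (simp add: mult.assoc left_diff_distrib lp_proj)
  next
    assume "x * lp a = 0"
    then have "x = x * (1 - lp a)" by (simp add: right_diff_distrib)
    then show "x * a = 0" using ann by blast
  qed
qed

lemma mult_eq_iff_mult_lp: "x * a = y * a \<longleftrightarrow> x * lp a = y * lp a"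
  using mult_eq_0_iff_mult_lp[of "x - y" a] by (simp add: left_diff_distrib)

lemma lp_mult_self: "lp a * a = a"
  using mult_eq_iff_mult_lp[of "lp a" a 1] by (simp add: lp_proj)

text \<open>For an idempotent \<open>p\<close>, \<open>x * p = 0\<close> amounts to
  \<open>x = x * (1 - p)\<close>, so the set equation in \<open>is_lp\<close> reduces to equality of
  left annihilators.\<close>

lemma is_lpI:
  assumes "p \<in> projections" and "\<And>x. x * a = 0 \<longleftrightarrow> x * p = 0"
  shows "is_lp a p"
proof -
  have "p * p = p" using assms(1) by (auto simp: projections_def)
  then have "(1 - p) * p = 0" by (simp add: left_diff_distrib)
  then have "{x. x * p = 0} = {y * (1 - p) | y. True}"
    by (auto simp: mult.assoc) (metis diff_0_right mult_1_right right_diff_distrib)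
  with assms show ?thesis by (simp add: is_lp_def)
qed

lemma lp_in_projections: "lp a \<in> projections"
  using is_lp_lp is_lp_def by blast

lemma proj_le_commute:
  assumes "p \<in> projections" and "q \<in> projections" and "proj_le p q"
  shows "q * p = p"
  using assms unfolding projections_def proj_le_def mem_Collect_eq by (metis star_mult)

lemma lp_proj_mult:
  assumes "p \<in> projections" and "proj_le p (lp b)"
  shows "lp (p * b) = p"
proof -
  have "x * (p * b) = 0 \<longleftrightarrow> x * p = 0" for x
    using mult_eq_0_iff_mult_lp[of "x * p" b] assms(2)
    by (simp add: proj_le_def mult.assoc)
  then show ?thesis using is_lpI[OF assms(1)] is_lp_lp is_lp_unique by blast
qed

text \<open>Cancelling \<open>a\<close> to \<open>lp a\<close> in \<open>lp b * a = a\<close> gives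
  \<open>lp b * lp a = lp a\<close>; applying \<open>star\<close> reverses the product.\<close>

lemma left_star_le_imp_proj_le:
  assumes "left_star_le a b"
  shows "proj_le (lp a) (lp b)"
proof -
  have "lp b * lp a = lp a"
    using mult_eq_iff_mult_lp[of "lp b" a 1] assms by (simp add: left_star_le_def)
  then show ?thesis unfolding proj_le_def by (metis star_mult lp_proj(1))
qed

text \<open>Since \<open>lp (p * b) = p\<close> and \<open>lp (q * b) = q\<close>, both defining
  equations reduce to \<open>p * q = p = q * p\<close>.\<close>

lemma left_star_le_proj_mult:
  assumes p: "p \<in> projections" "proj_le p (lp b)"
    and q: "q \<in> projections" "proj_le q (lp b)"
    and "proj_le p q"
  shows "left_star_le (p * b) (q * b)"
proof -
  have "p * q = p" using \<open>proj_le p q\<close> by (simp add: proj_le_def)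
  moreover have "q * p = p" using proj_le_commute p q \<open>proj_le p q\<close> by blast
  ultimately show ?thesis
    by (simp add: left_star_le_def lp_proj_mult p q flip: mult.assoc)
qed

lemma left_star_le_proj_mult_self:
  assumes "p \<in> projections" and "proj_le p (lp b)"
  shows "left_star_le (p * b) b"
  \<comment> \<open>This is the case \<open>q = lp b\<close>, where
    \<open>q * b = b\<close>.\<close>
  using left_star_le_proj_mult[OF assms lp_in_projections[of b]] assms(2)
  by (simp add: lp_mult_self proj_le_def lp_proj)

text \<open>Common template for all four intervals: \<open>sub\<close> makes \<open>lp\<close>
  monotone, \<open>hered\<close> makes its inverse monotone, and \<open>cond\<close> identifies the
  image of the interval.\<close>

lemma order_isomorphic_lp:
  assumes sub: "\<And>a a'. R a a' \<Longrightarrow> left_star_le a a'"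
    and hered: "\<And>a a'. \<lbrakk>R a b; R a' b; left_star_le a a'\<rbrakk> \<Longrightarrow> R a a'"
    and cond: "\<And>p. \<lbrakk>p \<in> projections; proj_le p (lp b)\<rbrakk> \<Longrightarrow> R (p * b) b \<longleftrightarrow> P p"
  shows "order_isomorphic {a. R a b} R {p \<in> projections. proj_le p (lp b) \<and> P p} proj_le"
    (is "order_isomorphic ?A R ?B proj_le")
proof -
  have lp_mult: "lp a * b = a" if "a \<in> ?A" for a
    using that sub by (auto simp: left_star_le_def)
  have lp_mem: "lp a \<in> ?B" if "a \<in> ?A" for a
  proof -
    have "proj_le (lp a) (lp b)" using that sub left_star_le_imp_proj_le by blast
    then show ?thesis using that cond[of "lp a"] lp_mult[OF that] lp_in_projections by auto
  qed
  have lp_inv: "lp (p * b) = p" "p * b \<in> ?A" if "p \<in> ?B" for p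
    using that cond lp_proj_mult by auto
  have inj: "inj_on lp ?A"
    by (rule inj_onI) (metis lp_mult)
  have bij: "bij_betw lp ?A ?B"
    by (rule bij_betw_byWitness[where f' = "\<lambda>p. p * b"]) (use lp_mult lp_mem lp_inv in auto)
  have inv: "the_inv_into ?A lp p = p * b" if "p \<in> ?B" for p
    using the_inv_into_f_eq[OF inj] lp_inv[OF that] by blast
  have "monotone_on ?A R proj_le lp"
    using sub left_star_le_imp_proj_le by (blast intro: monotone_onI)
  moreover have "monotone_on ?B proj_le R (the_inv_into ?A lp)"
  proof (rule monotone_onI)
    fix p q assume pq: "p \<in> ?B" "q \<in> ?B" "proj_le p q"
    then have "left_star_le (p * b) (q * b)" using left_star_le_proj_mult by blast
    then have "R (p * b) (q * b)" using hered lp_inv(2) pq by blast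
    then show "R (the_inv_into ?A lp p) (the_inv_into ?A lp q)" using inv pq by simp
  qed
  ultimately show ?thesis using bij unfolding order_isomorphic_def by blast
qed

lemma left_star_sq_le_iff:
  "left_star_sq_le a b \<longleftrightarrow> left_star_rsq_le a b \<and> left_star_lsq_le a b"
  by (auto simp: left_star_sq_le_def left_star_rsq_le_def left_star_lsq_le_def)

text \<open>Cancelling the last \<open>b\<close> in \<open>p * b * p * b = b * p * b\<close> leaves
  \<open>p * b * p = b * p\<close>; then \<open>lp b\<close> can be inserted before
  \<open>p\<close>.\<close>

lemma left_star_rsq_le_proj_mult:
  assumes "p \<in> projections" and "proj_le p (lp b)"
  shows "left_star_rsq_le (p * b) b \<longleftrightarrow> p * (b * lp b) * p = b * lp b * p"
proof -
  have "p * lp b = p" using assms(2) by (simp add: proj_le_def)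
  moreover have "lp b * p = p" using proj_le_commute assms lp_in_projections by blast
  ultimately show ?thesis
    using mult_eq_iff_mult_lp[of "p * b * p" b "b * p"] left_star_le_proj_mult_self[OF assms]
    by (simp add: left_star_rsq_le_def mult.assoc)
qed

text \<open>Here the last \<open>b\<close> of \<open>p * b * b\<close> itself becomes
  \<open>lp b\<close>, while \<open>p * b * p\<close> absorbs it.\<close>

lemma left_star_lsq_le_proj_mult:
  assumes "p \<in> projections" and "proj_le p (lp b)"
  shows "left_star_lsq_le (p * b) b \<longleftrightarrow> p * (b * lp b) * p = p * (b * lp b)"
proof -
  have "p * lp b = p" using assms(2) by (simp add: proj_le_def)
  moreover have "lp b * p = p" using proj_le_commute assms lp_in_projections by blast
  ultimately show ?thesis
    using mult_eq_iff_mult_lp[of "p * b * p" b "p * b"] left_star_le_proj_mult_self[OF assms]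
    by (simp add: left_star_lsq_le_def mult.assoc)
qed

lemma left_star_sq_le_proj_mult:
  assumes "p \<in> projections" and "proj_le p (lp b)"
  shows "left_star_sq_le (p * b) b \<longleftrightarrow> p * (b * lp b) = b * lp b * p"
proof -
  have "p * p = p" using assms(1) by (auto simp: projections_def)
  \<comment> \<open>Conversely, multiplying the commutation relation by \<open>p\<close> on the
    right and on the left gives the two equations.\<close>
  then have "p * (b * lp b) * p = b * lp b * p \<and> p * (b * lp b) * p = p * (b * lp b)
    \<longleftrightarrow> p * (b * lp b) = b * lp b * p"
    by (metis mult.assoc)
  then show ?thesis
    unfolding left_star_sq_le_iff left_star_rsq_le_proj_mult[OF assms]
      left_star_lsq_le_proj_mult[OF assms] .
qed

text \<open>Write the left factor of \<open>a' * a\<close> as \<open>lp a' * b\<close>; then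
  \<open>b * a = a * a\<close>, and \<open>lp a'\<close> fixes \<open>a\<close>.\<close>

lemma left_star_rsq_le_hered:
  assumes "left_star_rsq_le a b" and "left_star_rsq_le a' b" and le: "left_star_le a a'"
  shows "left_star_rsq_le a a'"
proof -
  have "a' * a = lp a' * (b * a)"
    using assms(2) by (simp add: left_star_rsq_le_def left_star_le_def flip: mult.assoc)
  also have "\<dots> = lp a' * a * a"
    using assms(1) by (simp add: left_star_rsq_le_def mult.assoc)
  also have "\<dots> = a * a" using le by (simp add: left_star_le_def)
  finally show ?thesis using le by (simp add: left_star_rsq_le_def)
qed

text \<open>Writing \<open>a\<close> as \<open>lp a * a'\<close> brings in \<open>a' * a'\<close>,
  which can be traded for \<open>a' * b\<close>.\<close>

lemma left_star_lsq_le_hered: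
  assumes "left_star_lsq_le a b" and "left_star_lsq_le a' b" and le: "left_star_le a a'"
  shows "left_star_lsq_le a a'"
proof -
  have a: "lp a * a' = a" using le by (simp add: left_star_le_def)
  have "a * a' = lp a * (a' * a')" using a by (simp flip: mult.assoc)
  also have "\<dots> = lp a * (a' * b)" using assms(2) by (simp add: left_star_lsq_le_def)
  also have "\<dots> = a * b" using a by (simp flip: mult.assoc)
  also have "\<dots> = a * a" using assms(1) by (simp add: left_star_lsq_le_def)
  finally show ?thesis using le by (simp add: left_star_lsq_le_def)
qed

theorem theorem25:
  fixes b :: "'a::rickart_star_ring"
  shows
    "let b\<^sub>l = b * lp b in
     order_isomorphic {a. left_star_le a b} left_star_le
       {p \<in> projections. proj_le p (lp b)} proj_le \<and>
     order_isomorphic {a. left_star_rsq_le a b} left_star_rsq_le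
       {p \<in> projections. proj_le p (lp b) \<and> p * b\<^sub>l * p = b\<^sub>l * p} proj_le \<and>
     order_isomorphic {a. left_star_lsq_le a b} left_star_lsq_le
       {p \<in> projections. proj_le p (lp b) \<and> p * b\<^sub>l * p = p * b\<^sub>l} proj_le \<and>
     order_isomorphic {a. left_star_sq_le a b} left_star_sq_le
       {p \<in> projections. proj_le p (lp b) \<and> p * b\<^sub>l = b\<^sub>l * p} proj_le"
proof -
  \<comment> \<open>The conjunct \<open>True\<close> fits this case to the template, with
    \<open>P\<close> constantly true.\<close>
  have "order_isomorphic {a. left_star_le a b} left_star_le
      {p \<in> projections. proj_le p (lp b) \<and> True} proj_le"
    by (rule order_isomorphic_lp) (simp_all add: left_star_le_proj_mult_self)
  moreover have "order_isomorphic {a. left_star_rsq_le a b} left_star_rsq_le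
      {p \<in> projections. proj_le p (lp b) \<and> p * (b * lp b) * p = b * lp b * p} proj_le"
  proof (rule order_isomorphic_lp)
    show "left_star_le a a'" if "left_star_rsq_le a a'" for a a' :: 'a
      using that by (simp add: left_star_rsq_le_def)
  qed (rule left_star_rsq_le_hered left_star_rsq_le_proj_mult; assumption)+
  moreover have "order_isomorphic {a. left_star_lsq_le a b} left_star_lsq_le
      {p \<in> projections. proj_le p (lp b) \<and> p * (b * lp b) * p = p * (b * lp b)} proj_le"
  proof (rule order_isomorphic_lp)
    show "left_star_le a a'" if "left_star_lsq_le a a'" for a a' :: 'a
      using that by (simp add: left_star_lsq_le_def)
  qed (rule left_star_lsq_le_hered left_star_lsq_le_proj_mult; assumption)+
  moreover have "order_isomorphic {a. left_star_sq_le a b} left_star_sq_le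
      {p \<in> projections. proj_le p (lp b) \<and> p * (b * lp b) = b * lp b * p} proj_le"
  proof (rule order_isomorphic_lp)
    show "left_star_le a a'" if "left_star_sq_le a a'" for a a' :: 'a
      using that by (simp add: left_star_sq_le_def)
    show "left_star_sq_le a a'"
      if "left_star_sq_le a b" "left_star_sq_le a' b" "left_star_le a a'" for a a'
      using that left_star_rsq_le_hered left_star_lsq_le_hered
      unfolding left_star_sq_le_iff by blast
  qed (rule left_star_sq_le_proj_mult)
  ultimately show ?thesis by (simp add: Let_def)
qed

end
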